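(* There is no weak embedding of van Oosten's model $\mathcal{B}$ into Kleene's second model $\mathcal{K}_2$; that is, $\mathcal{B} \not\hookrightarrow \mathcal{K}_2$.
   Context: A partial applicative system is a set $A$ with a partial binary operation (application) $(a,b)\mapsto ab$; we write $ab\!\downarrow$ when it is defined. For pcas (partial applicative systems satisfying combinatory completeness) $\mathcal{A},\mathcal{C}$, a weak embedding is an injection $F:\mathcal{A}\to\mathcal{C}$ such that for all $a,b\in\mathcal{A}$: if $\mathcal{A}\models ab\!\downarrow$ then $\mathcal{C}\models F(a)F(b)\!\downarrow = F(ab)$. We write $\mathcal{A}\hookrightarrow\mathcal{C}$ if such an embedding exists. $\Phi_e^{Z}$ denotes the $e$-th partial computable functional with oracle $Z$. Kleene's second model $\mathcal{K}_2$ has domain Baire space $\omega^\omega$ with application $f\cdot g = \Phi_{f(0)}^{f\oplus g}$, defined exactly when this is a total function. Van Oosten's model $\mathcal{B}$ has as domain all partial functions $\omega\to\omega$, with application $f\cdot g$ the partial function $n\mapsto \Phi_{f(0)}^{f\oplus g}(n)$, where an oracle computation with a partial oracle is undefined as soon as it queries a point where the oracle is undefined (so application in $\mathcal{B}$ is total). *)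

theory Defs
  imports Main "HOL-Library.Nat_Bijection"
begin

text \<open>Programs for partial recursive functions relative to an oracle: the usual schemes of zero,
  successor, projection, composition, primitive recursion and minimisation, together with the
  oracle call \<open>Orc\<close>.\<close>

datatype orec =
    Zero
  | Succ
  | Proj nat
  | Orc
  | Comp orec "orec list"
  | Prec orec orec
  | Mu orec

text \<open>Evaluation is strict: it is undefined as soon as some required subcomputation, in particular
  an oracle query, is undefined. Minimisation \<open>Mu\<close> searches through \<open>0, 1, 2, \<dots>\<close> and therefore
  needs defined nonzero values before the first zero.\<close>

fun oeval :: "(nat \<rightharpoonup> nat) \<Rightarrow> orec \<Rightarrow> nat list \<Rightarrow> nat option" where
  "oeval Z Zero xs = Some 0"
| "oeval Z Succ xs = (case xs of [x] \<Rightarrow> Some (Suc x) | _ \<Rightarrow> None)"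
| "oeval Z (Proj i) xs = (if i < length xs then Some (xs ! i) else None)"
| "oeval Z Orc xs = (case xs of [x] \<Rightarrow> Z x | _ \<Rightarrow> None)"
| "oeval Z (Comp p qs) xs =
    (let ys = map (\<lambda>q. oeval Z q xs) qs
     in if None \<in> set ys then None else oeval Z p (map the ys))"
| "oeval Z (Prec p q) xs =
    (case xs of
       [] \<Rightarrow> None
     | n # zs \<Rightarrow>
         rec_nat (oeval Z p zs) (\<lambda>k r. Option.bind r (\<lambda>y. oeval Z q (k # y # zs))) n)"
| "oeval Z (Mu p) xs =
    (if \<exists>n. oeval Z p (n # xs) = Some 0 \<and> (\<forall>m<n. oeval Z p (m # xs) \<noteq> None)
     then Some (LEAST n. oeval Z p (n # xs) = Some 0)
     else None)"

primrec code :: "orec \<Rightarrow> nat" where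
  "code Zero = prod_encode (0, 0)"
| "code Succ = prod_encode (1, 0)"
| "code (Proj i) = prod_encode (2, i)"
| "code Orc = prod_encode (3, 0)"
| "code (Comp p qs) = prod_encode (4, prod_encode (code p, list_encode (map code qs)))"
| "code (Prec p q) = prod_encode (5, prod_encode (code p, code q))"
| "code (Mu p) = prod_encode (6, code p)"

lemma code_eq_iff: "code p = code q \<longleftrightarrow> p = q"
proof
  show "code p = code q \<Longrightarrow> p = q"
  proof (induction p arbitrary: q)
    case (Comp p ps)
    then obtain p' ps' where q: "q = Comp p' ps'"
      by (cases q) (auto simp: prod_encode_eq)
    with Comp.prems have "p = p'" "map code ps = map code ps'"
      using Comp.IH(1) by (auto simp: prod_encode_eq list_encode_eq)
    moreover from this(2) have "ps = ps'"
      using Comp.IH(2) by (induction ps arbitrary: ps') (auto simp: Cons_eq_map_conv)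
    ultimately show ?case by (simp add: q)
  qed (case_tac q; force simp: prod_encode_eq)+
qed simp

text \<open>The \<open>e\<close>-th partial computable functional with a possibly partial oracle; numbers that are not
  codes of programs index the nowhere defined functional.\<close>

definition Phi :: "nat \<Rightarrow> (nat \<rightharpoonup> nat) \<Rightarrow> (nat \<rightharpoonup> nat)" where
  "Phi e Z = (\<lambda>n. if e \<in> range code then oeval Z (inv code e) [n] else None)"

definition join :: "(nat \<Rightarrow> 'a) \<Rightarrow> (nat \<Rightarrow> 'a) \<Rightarrow> nat \<Rightarrow> 'a" (infixl "\<oplus>" 65) where
  "(f \<oplus> g) n = (if even n then f (n div 2) else g (n div 2))"

text \<open>A partial applicative system whose underlying set is the type \<open>'a\<close> is given by its partial
  application.\<close>

type_synonym 'a pas = "'a \<Rightarrow> 'a \<Rightarrow> 'a option"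

definition weak_embedding :: "'a pas \<Rightarrow> 'c pas \<Rightarrow> ('a \<Rightarrow> 'c) \<Rightarrow> bool" where
  "weak_embedding A C F \<longleftrightarrow>
    inj F \<and> (\<forall>a b c. A a b = Some c \<longrightarrow> C (F a) (F b) = Some (F c))"

definition weakly_embeds :: "'a pas \<Rightarrow> 'c pas \<Rightarrow> bool" (infix "\<hookrightarrow>" 50) where
  "A \<hookrightarrow> C \<longleftrightarrow> (\<exists>F. weak_embedding A C F)"

definition K2 :: "(nat \<Rightarrow> nat) pas" where
  "K2 f g =
    (let h = Phi (f 0) (Some \<circ> (f \<oplus> g))
     in if \<forall>n. h n \<noteq> None then Some (\<lambda>n. the (h n)) else None)"

text \<open>If \<open>f 0\<close> is undefined, then there is no functional to run and \<open>f \<cdot> g\<close> is nowhere defined.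
  The result is always \<open>Some\<close>: application is total, and nowhere defined is a genuine element.\<close>

definition vanOosten_B :: "(nat \<rightharpoonup> nat) pas" where
  "vanOosten_B f g =
    Some (\<lambda>n. case f 0 of None \<Rightarrow> None | Some e \<Rightarrow> Phi e (f \<oplus> g) n)"

end

theory Submission
  imports Defs
begin

text \<open>Application in \<open>K2\<close> is continuous, since a converging computation reads only finitely much of
  its oracle. In \<open>vanOosten_B\<close> there are continuum many total elements \<open>marker S\<close> and, for each
  \<open>S\<close>, an element \<open>tester S\<close> that sends \<open>marker S\<close> to the nowhere defined function and every other
  marker to the constant zero function. Under a weak embedding \<open>F\<close>, continuity of application by
  \<open>F (tester S)\<close> makes \<open>F (marker S)\<close> isolated among the images of the markers. Hence these images
  would form an uncountable discrete subspace of the second countable Baire space.\<close>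

text \<open>The maximum of the finitely many bounds works. It serves where one evaluation depends on
  several others: the arguments of \<open>Comp\<close> and the values tested by
  \<open>Mu\<close>.\<close>

lemma uniform_agreement_bound:
  fixes Z :: "nat \<Rightarrow> 'b" and Q :: "'a \<Rightarrow> (nat \<Rightarrow> 'b) \<Rightarrow> bool"
  assumes "finite A" "\<And>a. a \<in> A \<Longrightarrow> \<exists>k. \<forall>Z'. (\<forall>i<k. Z' i = Z i) \<longrightarrow> Q a Z'"
  shows "\<exists>k. \<forall>a\<in>A. \<forall>Z'. (\<forall>i<k. Z' i = Z i) \<longrightarrow> Q a Z'"
  using assms
proof (induction A)
  case (insert a A)
  from insert.IH[OF insert.prems[OF insertI2]]
  obtain k where k: "\<forall>a\<in>A. \<forall>Z'. (\<forall>i<k. Z' i = Z i) \<longrightarrow> Q a Z'" ..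
  from insert.prems[OF insertI1]
  obtain l where l: "\<forall>Z'. (\<forall>i<l. Z' i = Z i) \<longrightarrow> Q a Z'" ..
  have "\<forall>b\<in>insert a A. \<forall>Z'. (\<forall>i<max k l. Z' i = Z i) \<longrightarrow> Q b Z'"
    using k l by simp
  then show ?case ..
qed simp

text \<open>Without \<open>LEAST\<close>, success with result \<open>n\<close> visibly depends only
  on the values of \<open>p\<close> at \<open>0, \<dots>, n\<close>.\<close>

lemma oeval_Mu_eq_Some_iff:
  "oeval Z (Mu p) xs = Some n \<longleftrightarrow>
    oeval Z p (n # xs) = Some 0 \<and> (\<forall>m<n. \<exists>v. oeval Z p (m # xs) = Some (Suc v))"
proof
  assume L: "oeval Z (Mu p) xs = Some n"
  then obtain n' where n': "oeval Z p (n' # xs) = Some 0" "\<forall>m<n'. oeval Z p (m # xs) \<noteq> None"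
    and n: "n = (LEAST n. oeval Z p (n # xs) = Some 0)"
    by (auto split: if_splits)
  from n'(1) have "oeval Z p (n # xs) = Some 0" "n \<le> n'"
    unfolding n by (rule LeastI, rule Least_le)
  moreover have "\<exists>v. oeval Z p (m # xs) = Some (Suc v)" if "m < n" for m
  proof -
    have "oeval Z p (m # xs) \<noteq> Some 0" using that not_less_Least unfolding n by blast
    moreover have "oeval Z p (m # xs) \<noteq> None" using n'(2) that \<open>n \<le> n'\<close> by simp
    ultimately show ?thesis by (metis not0_implies_Suc option.exhaust)
  qed
  ultimately show "oeval Z p (n # xs) = Some 0 \<and> (\<forall>m<n. \<exists>v. oeval Z p (m # xs) = Some (Suc v))"
    by blast
next
  assume R: "oeval Z p (n # xs) = Some 0 \<and> (\<forall>m<n. \<exists>v. oeval Z p (m # xs) = Some (Suc v))"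
  then have "(LEAST n. oeval Z p (n # xs) = Some 0) = n"
    by (intro Least_equality) (force simp: not_less[symmetric])+
  moreover have "\<exists>n. oeval Z p (n # xs) = Some 0 \<and> (\<forall>m<n. oeval Z p (m # xs) \<noteq> None)"
    using R by (intro exI[of _ n]) auto
  ultimately show "oeval Z (Mu p) xs = Some n" by simp
qed

lemma oeval_finite_use:
  assumes "oeval Z p xs = Some y"
  shows "\<exists>k. \<forall>Z'. (\<forall>i<k. Z' i = Z i) \<longrightarrow> oeval Z' p xs = Some y"
  using assms
proof (induction p arbitrary: xs y)
  case Orc
  then obtain x where x: "xs = [x]" "Z x = Some y" by (auto split: list.splits)
  then show ?case by (intro exI[of _ "Suc x"]) simp
next
  case (Comp p qs)
  let ?ys = "map (\<lambda>q. the (oeval Z q xs)) qs"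
  have defd: "None \<notin> set (map (\<lambda>q. oeval Z q xs) qs)"
    using Comp.prems by (auto simp: Let_def)
  have "oeval Z p ?ys = Some y"
    using Comp.prems by (simp add: Let_def comp_def split: if_splits)
  then obtain k where k: "\<forall>Z'. (\<forall>i<k. Z' i = Z i) \<longrightarrow> oeval Z' p ?ys = Some y"
    using Comp.IH(1) by blast
  have "\<exists>l. \<forall>q\<in>set qs. \<forall>Z'. (\<forall>i<l. Z' i = Z i) \<longrightarrow> oeval Z' q xs = oeval Z q xs"
  proof (rule uniform_agreement_bound)
    fix q assume q: "q \<in> set qs"
    then obtain v where v: "oeval Z q xs = Some v"
      using defd by (cases "oeval Z q xs") force+
    show "\<exists>l. \<forall>Z'. (\<forall>i<l. Z' i = Z i) \<longrightarrow> oeval Z' q xs = oeval Z q xs"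
      using Comp.IH(2)[OF q v] v by simp
  qed simp
  then obtain l where
    l: "\<forall>q\<in>set qs. \<forall>Z'. (\<forall>i<l. Z' i = Z i) \<longrightarrow> oeval Z' q xs = oeval Z q xs" by blast
  show ?case
  proof (intro exI[of _ "max k l"] allI impI)
    fix Z' assume Z': "\<forall>i<max k l. Z' i = Z i"
    have "oeval Z' q xs = oeval Z q xs" if "q \<in> set qs" for q
      using Z' by (intro l[rule_format, OF that]) simp
    then have eq: "map (\<lambda>q. oeval Z' q xs) qs = map (\<lambda>q. oeval Z q xs) qs" by simp
    show "oeval Z' (Comp p qs) xs = Some y"
      using k Z' defd unfolding oeval.simps(5) Let_def eq by (simp add: comp_def)
  qed
next
  case (Prec p q)
  then obtain n zs where xs: "xs = n # zs" by (cases xs) auto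
  \<comment> \<open>An inner induction on the recursion argument; \<open>y\<close> varies because
    each stage has its own intermediate value.\<close>
  have "\<exists>k. \<forall>Z'. (\<forall>i<k. Z' i = Z i) \<longrightarrow> oeval Z' (Prec p q) (n # zs) = Some y"
    if "oeval Z (Prec p q) (n # zs) = Some y" for y
    using that
  proof (induction n arbitrary: y)
    case 0
    then show ?case using Prec.IH(1) by simp
  next
    case (Suc n)
    then obtain v where v: "oeval Z (Prec p q) (n # zs) = Some v"
      and y: "oeval Z q (n # v # zs) = Some y"
      by (auto simp: bind_eq_Some_conv)
    obtain k where k: "\<forall>Z'. (\<forall>i<k. Z' i = Z i) \<longrightarrow> oeval Z' (Prec p q) (n # zs) = Some v"
      using Suc.IH[OF v] by blast
    obtain l where l: "\<forall>Z'. (\<forall>i<l. Z' i = Z i) \<longrightarrow> oeval Z' q (n # v # zs) = Some y"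
      using Prec.IH(2)[OF y] by blast
    show ?case
      using k l by (intro exI[of _ "max k l"]) (simp add: bind_eq_Some_conv)
  qed
  then show ?case using Prec.prems unfolding xs by blast
next
  case (Mu p)
  note n = Mu.prems[unfolded oeval_Mu_eq_Some_iff]
  have "\<exists>k. \<forall>m\<in>{..y}. \<forall>Z'. (\<forall>i<k. Z' i = Z i) \<longrightarrow> oeval Z' p (m # xs) = oeval Z p (m # xs)"
  proof (rule uniform_agreement_bound)
    fix m assume "m \<in> {..y}"
    then have "m < y \<or> m = y" by auto
    then obtain v where v: "oeval Z p (m # xs) = Some v"
      using n by blast
    show "\<exists>k. \<forall>Z'. (\<forall>i<k. Z' i = Z i) \<longrightarrow> oeval Z' p (m # xs) = oeval Z p (m # xs)"
      using Mu.IH[OF v] v by simp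
  qed simp
  then obtain k where
    k: "\<forall>m\<in>{..y}. \<forall>Z'. (\<forall>i<k. Z' i = Z i) \<longrightarrow> oeval Z' p (m # xs) = oeval Z p (m # xs)"
    by blast
  show ?case
  proof (intro exI[of _ k] allI impI)
    fix Z' assume Z': "\<forall>i<k. Z' i = Z i"
    have "oeval Z' p (m # xs) = oeval Z p (m # xs)" if "m \<le> y" for m
      using Z' that by (intro k[rule_format]) simp_all
    then show "oeval Z' (Mu p) xs = Some y"
      using n unfolding oeval_Mu_eq_Some_iff by simp
  qed
qed auto

lemma K2_continuous_right:
  assumes "K2 f g = Some h"
  shows "\<exists>k. \<forall>g' h'. (\<forall>i<k. g' i = g i) \<longrightarrow> K2 f g' = Some h' \<longrightarrow> h' n = h n"
proof -
  have *: "f 0 \<in> range code \<and> oeval (Some \<circ> (f \<oplus> g')) (inv code (f 0)) [n] = Some (h' n)"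
    if "K2 f g' = Some h'" for g' h'
  proof -
    have "Phi (f 0) (Some \<circ> (f \<oplus> g')) n = Some (h' n)"
      using that by (auto simp: K2_def Let_def split: if_splits)
    then show ?thesis by (simp add: Phi_def split: if_splits)
  qed
  from oeval_finite_use[OF conjunct2[OF *[OF assms]]]
  obtain k where k: "\<forall>Z'. (\<forall>i<k. Z' i = (Some \<circ> (f \<oplus> g)) i) \<longrightarrow>
      oeval Z' (inv code (f 0)) [n] = Some (h n)" ..
  show ?thesis
  proof (intro exI[of _ k] allI impI)
    fix g' h' assume "\<forall>i<k. g' i = g i" and h': "K2 f g' = Some h'"
    \<comment> \<open>Position \<open>i\<close> of the join reads an argument at
      \<open>i div 2 \<le> i\<close>, so the bound for the oracle also serves for
      \<open>g\<close>.\<close>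
    then have "\<forall>i<k. (Some \<circ> (f \<oplus> g')) i = (Some \<circ> (f \<oplus> g)) i" by (simp add: join_def)
    then have "oeval (Some \<circ> (f \<oplus> g')) (inv code (f 0)) [n] = Some (h n)"
      by (rule k[THEN spec, THEN mp])
    with *[OF h'] show "h' n = h n" by simp
  qed
qed

text \<open>The values of a marker are themselves positions, all even and nonzero, in the oracle
  \<open>tester S \<oplus> marker T\<close>. Position \<open>4 * n + 2\<close> or \<open>4 * n + 4\<close> holds 1 or 0 according to whether the
  claim it encodes about \<open>n \<in> T\<close> is correct for \<open>S\<close>, so comparing \<open>S\<close> and \<open>T\<close> at \<open>n\<close> takes just two
  nested queries.\<close>

definition marker :: "nat set \<Rightarrow> (nat \<rightharpoonup> nat)" where
  "marker S n = Some (4 * n + 2 + (if n \<in> S then 2 else 0))"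

text \<open>Computes \<open>2 * n + 1\<close>, where the join holds \<open>marker T n\<close>;
  \<open>Proj 1\<close> is the previous value of the recursion.\<close>

definition odd_prog :: orec where
  "odd_prog = Prec (Comp Succ [Zero]) (Comp Succ [Comp Succ [Proj 1]])"

text \<open>The search stops at the first \<open>n\<close> on which \<open>S\<close> and
  \<open>T\<close> differ. The outer \<open>Zero\<close> forgets this \<open>n\<close> but, by
  strictness, keeps divergence.\<close>

definition search_prog :: orec where
  "search_prog = Comp Zero [Mu (Comp Orc [Comp Orc [odd_prog]])]"

text \<open>Entry \<open>0\<close> is taken by the program index. In entry \<open>Suc j\<close>, the
  parity of \<open>j\<close> encodes the claim (odd for membership) about the number
  \<open>j div 2\<close>.\<close>

definition tester :: "nat set \<Rightarrow> (nat \<rightharpoonup> nat)" where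
  "tester S m = Some (case m of 0 \<Rightarrow> code search_prog
     | Suc j \<Rightarrow> if odd j \<longleftrightarrow> j div 2 \<in> S then 1 else 0)"

lemma oeval_odd_prog: "oeval Z odd_prog [n, x] = Some (Suc (2 * n))"
  unfolding odd_prog_def by (induction n) auto

lemma tester_join_marker_queries:
  "(tester S \<oplus> marker T) (Suc (2 * n)) = marker T n"
  "(tester S \<oplus> marker T) (4 * n + 2 + (if n \<in> T then 2 else 0)) =
    Some (if n \<in> T \<longleftrightarrow> n \<in> S then 1 else 0)"
proof -
  have "(4 * n + 2) div 2 = Suc (2 * n)" "(4 * n + 4) div 2 = Suc (Suc (2 * n))" by simp_all
  then show "(tester S \<oplus> marker T) (4 * n + 2 + (if n \<in> T then 2 else 0)) =
      Some (if n \<in> T \<longleftrightarrow> n \<in> S then 1 else 0)"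
    by (simp add: join_def tester_def)
qed (simp add: join_def)

lemma oeval_search_prog:
  "oeval (tester S \<oplus> marker T) search_prog [x] = (if S = T then None else Some 0)"
proof -
  let ?Z = "tester S \<oplus> marker T" and ?body = "Comp Orc [Comp Orc [odd_prog]]"
  \<comment> \<open>The body is defined at every \<open>n\<close>, so the search can diverge only
    for want of a zero.\<close>
  have body: "oeval ?Z ?body [n, x] = Some (if n \<in> T \<longleftrightarrow> n \<in> S then 1 else 0)" for n
    using tester_join_marker_queries(2)[of S T n]
    by (simp add: oeval_odd_prog tester_join_marker_queries(1) marker_def del: oeval.simps(6))
  have "oeval ?Z (Mu ?body) [x] = None \<longleftrightarrow> S = T"
    unfolding oeval.simps(7) body by auto
  then show ?thesis
    unfolding search_prog_def by (auto simp del: oeval.simps(7))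
qed

lemma vanOosten_B_tester_marker:
  "vanOosten_B (tester S) (marker T) = Some (if S = T then Map.empty else (\<lambda>_. Some 0))"
proof -
  have "inj code" by (simp add: inj_def code_eq_iff)
  then have "Phi (code search_prog) Z n = oeval Z search_prog [n]" for Z n
    by (simp add: Phi_def)
  then show ?thesis
    by (auto simp: vanOosten_B_def tester_def[of S 0] oeval_search_prog)
qed

text \<open>An isolating initial segment of \<open>G S\<close> determines \<open>S\<close> and is
  coded by a number, so \<open>nat set\<close> would inject into \<open>nat\<close>, against
  Cantor.\<close>

lemma no_uncountable_discrete_family:
  fixes G :: "nat set \<Rightarrow> nat \<Rightarrow> nat"
  shows "\<not> (\<forall>S. \<exists>k. \<forall>T. (\<forall>i<k. G T i = G S i) \<longrightarrow> T = S)"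
proof
  assume "\<forall>S. \<exists>k. \<forall>T. (\<forall>i<k. G T i = G S i) \<longrightarrow> T = S"
  then obtain k where k: "\<And>S T. \<forall>i<k S. G T i = G S i \<Longrightarrow> T = S" by metis
  define c where "c S = list_encode (map (G S) [0..<k S])" for S
  have "inj c"
  proof (rule injI)
    fix S T assume "c S = c T"
    then have eq: "map (G S) [0..<k S] = map (G T) [0..<k T]"
      by (simp add: c_def list_encode_eq)
    then have "k S = k T" by (metis length_map length_upt diff_zero)
    with eq show "S = T" using k[of T S] by simp
  qed
  then have "surj (inv c)" by (rule inj_imp_surj_inv)
  then show False using Cantors_theorem[of UNIV] by (metis Pow_UNIV)
qed

theorem theorem2p1: "\<not> vanOosten_B \<hookrightarrow> K2"
proof
  assume "vanOosten_B \<hookrightarrow> K2"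
  then obtain F where "inj F"
    and F: "\<And>a b c. vanOosten_B a b = Some c \<Longrightarrow> K2 (F a) (F b) = Some (F c)"
    by (auto simp: weakly_embeds_def weak_embedding_def)
  have "F Map.empty \<noteq> F (\<lambda>_. Some 0)"
    using \<open>inj F\<close> by (auto dest: injD fun_cong)
  \<comment> \<open>At this coordinate the two possible results of a test stay distinguishable in
    \<open>K2\<close>; continuity is applied there.\<close>
  then obtain n where n: "F Map.empty n \<noteq> F (\<lambda>_. Some 0) n" by blast
  have "\<exists>k. \<forall>T. (\<forall>i<k. F (marker T) i = F (marker S) i) \<longrightarrow> T = S" for S
  proof -
    have "K2 (F (tester S)) (F (marker S)) = Some (F Map.empty)"
      by (rule F) (simp add: vanOosten_B_tester_marker)
    from K2_continuous_right[OF this, of n]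
    obtain k where k: "\<forall>g h. (\<forall>i<k. g i = F (marker S) i) \<longrightarrow>
        K2 (F (tester S)) g = Some h \<longrightarrow> h n = F Map.empty n" ..
    have "T = S" if "\<forall>i<k. F (marker T) i = F (marker S) i" for T
    proof (rule ccontr)
      assume "T \<noteq> S"
      then have "K2 (F (tester S)) (F (marker T)) = Some (F (\<lambda>_. Some 0))"
        by (intro F) (simp add: vanOosten_B_tester_marker)
      with k that have "F (\<lambda>_. Some 0) n = F Map.empty n" by blast
      with n show False by simp
    qed
    then show ?thesis by blast
  qed
  with no_uncountable_discrete_family[of "\<lambda>S. F (marker S)"] show False by blast
qed

end
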